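(* For a disjunction $\bigvee_{l\in\mathcal D}\big[\,g_l(\boldsymbol x)\le b_l,\ \boldsymbol x\in\mathcal X\,\big]$ with additive bounds, a $(P+1)$-split formulation obtained by splitting one of the variable groups in a $P$-split formulation into two groups is always as tight as or tighter than the corresponding $P$-split formulation; that is, the projection onto the $\boldsymbol x$-space of the continuous relaxation of the $(P+1)$-split formulation is contained in the projection onto the $\boldsymbol x$-space of the continuous relaxation of the $P$-split formulation.
   Context: Setting. $\mathcal X\subset\mathbb R^n$ is a convex compact set, $\mathcal D$ is a finite set of disjunct indices, $b_l\in\mathbb R$, and $g_l(\boldsymbol x)=\sum_{i=1}^nh_{i,l}(x_i)$ with $h_{i,l}:\mathbb R\to\mathbb R$ convex; all $g_l$ are bounded on $\mathcal X$; each disjunct $\{\boldsymbol x\in\mathcal X:g_l(\boldsymbol x)\le b_l\}$ is non-empty. $P$-split formulation. Let $\mathcal I_1,\dots,\mathcal I_P$ be a partition of $\{1,\dots,n\}$ into $P$ pairwise disjoint non-empty sets (the variable groups). For $s\in\{1,\dots,P\}$, $l\in\mathcal D$ put $\underline{\alpha}^{l}_s=\min_{\boldsymbol x\in\mathcal X}\sum_{i\in\mathcal I_s}h_{i,l}(x_i)$ and $\bar\alpha^{l}_s=\max_{\boldsymbol x\in\mathcal X}\sum_{i\in\mathcal I_s}h_{i,l}(x_i)$. The $P$-split formulation has variables $\boldsymbol x\in\mathcal X$, $\alpha^{l}_s\in\mathbb R$, $\nu^{\alpha^{l}_s}_d\in\mathbb R$ ($d\in\mathcal D$), $\boldsymbol\lambda\in\{0,1\}^{|\mathcal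 D|}$ and constraints, for all $s\in\{1,\dots,P\}$, $l,d\in\mathcal D$: $$\alpha^{l}_s=\sum_{d'\in\mathcal D}\nu^{\alpha^{l}_s}_{d'},\quad \sum_{s'=1}^P\nu^{\alpha^{l}_{s'}}_l\le b_{l}\lambda_l,\quad \underline{\alpha}^{l}_s\lambda_d\le\nu^{\alpha^{l}_s}_d\le\bar\alpha^{l}_s\lambda_d,\quad \sum_{i\in\mathcal I_s}h_{i,l}(x_i)\le\alpha^{l}_s,\quad \sum_{l'\in\mathcal D}\lambda_{l'}=1.$$ Its continuous relaxation replaces $\boldsymbol\lambda\in\{0,1\}^{|\mathcal D|}$ by $\boldsymbol\lambda\in[0,1]^{|\mathcal D|}$. Splitting a group $\mathcal I_s$ means replacing it in the partition by two disjoint non-empty sets whose union is $\mathcal I_s$. Additive bounds. The disjunction has additive bounds if for every $l\in\mathcal D$ and all disjoint $\mathcal I,\mathcal I'\subset\{1,\dots,n\}$, $\min_{\boldsymbol x\in\mathcal X}\big(\sum_{i\in\mathcal I}h_{i,l}(x_i)+\sum_{i\in\mathcal I'}h_{i,l}(x_i)\big)=\min_{\boldsymbol x\in\mathcal X}\sum_{i\in\mathcal I}h_{i,l}(x_i)+\min_{\boldsymbol x\in\mathcal X}\sum_{i\in\mathcal I'}h_{i,l}(x_i)$, and the same identity holds with $\max$ in place of $\min$. *)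

theory Defs
  imports "HOL-Analysis.Analysis" "HOL-Library.Disjoint_Sets"
begin

definition group_sum :: "('n::finite \<Rightarrow> 'd \<Rightarrow> real \<Rightarrow> real) \<Rightarrow> 'd \<Rightarrow> 'n set \<Rightarrow> real ^ 'n \<Rightarrow> real" where
  "group_sum h l I x = (\<Sum>i\<in>I. h i l (x $ i))"

abbreviation constraint_fun :: "('n::finite \<Rightarrow> 'd \<Rightarrow> real \<Rightarrow> real) \<Rightarrow> 'd \<Rightarrow> real ^ 'n \<Rightarrow> real" where
  "constraint_fun h l \<equiv> group_sum h l UNIV"

(* Minimum and maximum of a function on a set. Both are meaningful only when attained; this is
   the case below, where continuous functions are optimised over a non-empty compact set. *)
definition min_on :: "'a set \<Rightarrow> ('a \<Rightarrow> real) \<Rightarrow> real" where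
  "min_on X f = (LEAST v. v \<in> f ` X)"

definition max_on :: "'a set \<Rightarrow> ('a \<Rightarrow> real) \<Rightarrow> real" where
  "max_on X f = (GREATEST v. v \<in> f ` X)"

definition additive_bounds ::
    "(real ^ 'n::finite) set \<Rightarrow> 'd set \<Rightarrow> ('n \<Rightarrow> 'd \<Rightarrow> real \<Rightarrow> real) \<Rightarrow> bool" where
  "additive_bounds X D h \<longleftrightarrow>
    (\<forall>l\<in>D. \<forall>I I'. I \<inter> I' = {} \<longrightarrow>
      min_on X (\<lambda>x. group_sum h l I x + group_sum h l I' x)
        = min_on X (group_sum h l I) + min_on X (group_sum h l I') \<and>
      max_on X (\<lambda>x. group_sum h l I x + group_sum h l I' x)
        = max_on X (group_sum h l I) + max_on X (group_sum h l I'))"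

(* Groups are pairwise disjoint and non-empty, hence distinct, so a partition into P groups is
   given as a set of P sets, and each group serves as its own index s. *)
definition variable_groups :: "nat \<Rightarrow> 'n::finite set set \<Rightarrow> bool" where
  "variable_groups P \<I> \<longleftrightarrow> partition_on UNIV \<I> \<and> card \<I> = P"

definition splits_one_group :: "'n set set \<Rightarrow> 'n set set \<Rightarrow> bool" where
  "splits_one_group \<I> \<J> \<longleftrightarrow>
    (\<exists>S\<in>\<I>. \<exists>A B. A \<noteq> {} \<and> B \<noteq> {} \<and> A \<inter> B = {} \<and> A \<union> B = S \<and> \<J> = (\<I> - {S}) \<union> {A, B})"

lemma variable_groups_split:
  assumes "variable_groups P \<I>" and "splits_one_group \<I> \<J>"
  shows "variable_groups (Suc P) \<J>"
proof -
  from assms(2) obtain S A B where S: "S \<in> \<I>" and AB: "A \<noteq> {}" "B \<noteq> {}" "A \<inter> B = {}"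
    and un: "A \<union> B = S" and J: "\<J> = (\<I> - {S}) \<union> {A, B}"
    unfolding splits_one_group_def by blast
  from assms(1) have U: "\<Union>\<I> = UNIV" and dis: "disjoint \<I>" and ne: "{} \<notin> \<I>"
    and card: "card \<I> = P"
    unfolding variable_groups_def partition_on_def by auto
  have sep: "T \<inter> S = {}" if "T \<in> \<I> - {S}" for T
    using dis S that by (auto simp: disjoint_def)
  have "A \<notin> \<I> - {S}" "B \<notin> \<I> - {S}" "A \<noteq> B"
    using sep AB un by blast+
  moreover have "card (\<I> - {S}) = P - 1" "P > 0"
    using S card by (auto simp: card_gt_0_iff)
  ultimately have "card \<J> = Suc P"
    unfolding J by simp
  moreover have "\<Union>\<J> = UNIV"
  proof -
    have "\<Union>\<J> = \<Union>(insert S (\<I> - {S}))" unfolding J using un by auto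
    then show ?thesis using S U by (simp add: insert_absorb)
  qed
  moreover have "disjoint \<J>"
    unfolding disjoint_def J
  proof (intro ballI impI)
    fix T T' assume *: "T \<in> \<I> - {S} \<union> {A, B}" "T' \<in> \<I> - {S} \<union> {A, B}" "T \<noteq> T'"
    show "T \<inter> T' = {}"
    proof (cases "T \<in> \<I> - {S} \<and> T' \<in> \<I> - {S}")
      case True
      then show ?thesis using dis * by (auto simp: disjoint_def)
    next
      case False
      then show ?thesis using * sep[of T] sep[of T'] AB un by blast
    qed
  qed
  moreover have "{} \<notin> \<J>" using ne AB unfolding J by auto
  ultimately show ?thesis
    unfolding variable_groups_def partition_on_def by auto
qed

(* Feasible points (x, alpha, nu, lambda), where alpha l s, nu l s d and lambda l are the variables
   for l, d in D and s in the partition; values outside these index sets are irrelevant and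
   unconstrained. Lambda is the range of each lambda l: {0, 1} gives the mixed-integer
   formulation, {0..1} its continuous relaxation. *)
definition split_feasible ::
    "real set \<Rightarrow> (real ^ 'n::finite) set \<Rightarrow> 'd set \<Rightarrow> ('n \<Rightarrow> 'd \<Rightarrow> real \<Rightarrow> real) \<Rightarrow> ('d \<Rightarrow> real) \<Rightarrow> 'n set set \<Rightarrow>
     ((real ^ 'n) \<times> ('d \<Rightarrow> 'n set \<Rightarrow> real) \<times> ('d \<Rightarrow> 'n set \<Rightarrow> 'd \<Rightarrow> real) \<times> ('d \<Rightarrow> real)) set" where
  "split_feasible \<Lambda> X D h b \<I> = {(x, \<alpha>, \<nu>, lam).
     x \<in> X \<and>
     (\<forall>l\<in>D. lam l \<in> \<Lambda>) \<and>
     (\<forall>l\<in>D. \<forall>s\<in>\<I>. \<alpha> l s = (\<Sum>d\<in>D. \<nu> l s d)) \<and>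
     (\<forall>l\<in>D. (\<Sum>s\<in>\<I>. \<nu> l s l) \<le> b l * lam l) \<and>
     (\<forall>l\<in>D. \<forall>s\<in>\<I>. \<forall>d\<in>D.
        min_on X (group_sum h l s) * lam d \<le> \<nu> l s d \<and>
        \<nu> l s d \<le> max_on X (group_sum h l s) * lam d) \<and>
     (\<forall>l\<in>D. \<forall>s\<in>\<I>. group_sum h l s x \<le> \<alpha> l s) \<and>
     (\<Sum>l\<in>D. lam l) = 1}"

abbreviation "split_formulation \<equiv> split_feasible {0, 1}"

abbreviation "split_relaxation \<equiv> split_feasible {0..1}"

abbreviation "proj_x F \<equiv> fst ` F"

end

theory Submission
  imports Defs
begin

text \<open>The finer relaxation maps to the coarser one with \<open>x\<close> and \<open>\<lambda>\<close> fixed: if \<open>A\<close> and \<open>B\<close>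
  are the two parts of the group \<open>S\<close>, give \<open>S\<close> the sums of the \<open>\<alpha>\<close> and \<open>\<nu>\<close> variables of \<open>A\<close> and
  \<open>B\<close>, and leave the other groups alone. Every constraint of \<open>S\<close> is then the sum of the
  corresponding constraints of \<open>A\<close> and \<open>B\<close>. For the constraints defining \<open>\<alpha>\<close> and linking it to \<open>x\<close>
  this is linearity and \<open>group_sum_Un\<close>; for the bounds on \<open>\<nu>\<close> it is the additivity of the bounds
  (\<open>min_on_Un\<close>, \<open>max_on_Un\<close>), without which the sum of the bounds of \<open>A\<close> and \<open>B\<close> could be weaker
  than the bound of \<open>S\<close>. The only constraint coupling the groups sums \<open>\<nu>\<close> over all of them, and
  this sum is unchanged (\<open>sum_merge_split\<close>).\<close>

lemma group_sum_Un:
  assumes "A \<inter> B = {}"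
  shows "group_sum h l (A \<union> B) x = group_sum h l A x + group_sum h l B x"
  unfolding group_sum_def using assms by (simp add: sum.union_disjoint)

lemma min_on_Un:
  assumes "additive_bounds X D h" and "l \<in> D" and "A \<inter> B = {}"
  shows "min_on X (group_sum h l (A \<union> B)) = min_on X (group_sum h l A) + min_on X (group_sum h l B)"
proof -
  have "group_sum h l (A \<union> B) = (\<lambda>x. group_sum h l A x + group_sum h l B x)"
    using group_sum_Un[OF assms(3)] by (rule ext)
  then show ?thesis
    using assms unfolding additive_bounds_def by simp
qed

lemma max_on_Un:
  assumes "additive_bounds X D h" and "l \<in> D" and "A \<inter> B = {}"
  shows "max_on X (group_sum h l (A \<union> B)) = max_on X (group_sum h l A) + max_on X (group_sum h l B)"
proof -
  have "group_sum h l (A \<union> B) = (\<lambda>x. group_sum h l A x + group_sum h l B x)"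
    using group_sum_Un[OF assms(3)] by (rule ext)
  then show ?thesis
    using assms unfolding additive_bounds_def by simp
qed

definition merge_split :: "'a set \<Rightarrow> 'a set \<Rightarrow> ('a set \<Rightarrow> real) \<Rightarrow> 'a set \<Rightarrow> real" where
  "merge_split A B f s = (if s = A \<union> B then f A + f B else f s)"

text \<open>Groups are their own indices, so the sum over the split partition must not identify a new part
  with the other part or with an old group; disjointness and non-emptiness exclude this.\<close>
lemma sum_merge_split:
  assumes "finite \<I>" and "disjoint \<I>" and "A \<union> B \<in> \<I>"
    and "A \<noteq> {}" and "B \<noteq> {}" and "A \<inter> B = {}"
  shows "(\<Sum>s\<in>\<I>. merge_split A B f s) = (\<Sum>s\<in>(\<I> - {A \<union> B}) \<union> {A, B}. f s)"
proof -
  have "T \<inter> (A \<union> B) = {}" if "T \<in> \<I> - {A \<union> B}" for T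
    using disjointD[OF assms(2), of T "A \<union> B"] that assms(3) by blast
  then have new: "A \<notin> \<I> - {A \<union> B}" "B \<notin> \<I> - {A \<union> B}" "A \<noteq> B"
    using assms(4-6) by blast+
  have "(\<Sum>s\<in>\<I>. merge_split A B f s)
      = merge_split A B f (A \<union> B) + (\<Sum>s\<in>\<I> - {A \<union> B}. merge_split A B f s)"
    by (rule sum.remove[OF assms(1,3)])
  also have "\<dots> = f A + f B + (\<Sum>s\<in>\<I> - {A \<union> B}. f s)"
    by (simp add: merge_split_def)
  also have "\<dots> = (\<Sum>s\<in>(\<I> - {A \<union> B}) \<union> {A, B}. f s)"
    using new assms(1) by simp
  finally show ?thesis .
qed

theorem theorem2:
  fixes X :: "(real ^ 'n::finite) set"
    and D :: "'d set"
    and h :: "'n \<Rightarrow> 'd \<Rightarrow> real \<Rightarrow> real"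
    and b :: "'d \<Rightarrow> real"
    and P :: nat
    and \<I> \<J> :: "'n set set"
  assumes "convex X" and "compact X"
    and "finite D"
    and "\<And>i l. l \<in> D \<Longrightarrow> convex_on UNIV (h i l)"
    and "\<And>l. l \<in> D \<Longrightarrow> bounded (constraint_fun h l ` X)"
    and "\<And>l. l \<in> D \<Longrightarrow> {x \<in> X. constraint_fun h l x \<le> b l} \<noteq> {}"
    and "additive_bounds X D h"
    and "variable_groups P \<I>"
    and "splits_one_group \<I> \<J>"
  shows "proj_x (split_relaxation X D h b \<J>) \<subseteq> proj_x (split_relaxation X D h b \<I>)"
proof
  fix x assume "x \<in> proj_x (split_relaxation X D h b \<J>)"
  then obtain \<alpha> \<nu> lam where feas: "(x, \<alpha>, \<nu>, lam) \<in> split_relaxation X D h b \<J>"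
    by force
  from assms(9) obtain A B where
    AB: "A \<union> B \<in> \<I>" "A \<noteq> {}" "B \<noteq> {}" "A \<inter> B = {}" and \<J>: "\<J> = (\<I> - {A \<union> B}) \<union> {A, B}"
    unfolding splits_one_group_def by blast
  have dis: "disjoint \<I>"
    using assms(8) unfolding variable_groups_def partition_on_def by blast
  have in\<J>: "A \<in> \<J>" "B \<in> \<J>" and old: "\<And>s. s \<in> \<I> \<Longrightarrow> s \<noteq> A \<union> B \<Longrightarrow> s \<in> \<J>"
    unfolding \<J> by auto
  have x: "x \<in> X" and lam: "\<forall>l\<in>D. lam l \<in> {0..1}" "(\<Sum>l\<in>D. lam l) = 1"
    and alpha: "\<And>l s. l \<in> D \<Longrightarrow> s \<in> \<J> \<Longrightarrow> \<alpha> l s = (\<Sum>d\<in>D. \<nu> l s d)"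
    and coupling: "\<And>l. l \<in> D \<Longrightarrow> (\<Sum>s\<in>\<J>. \<nu> l s l) \<le> b l * lam l"
    and lower: "\<And>l s d. l \<in> D \<Longrightarrow> s \<in> \<J> \<Longrightarrow> d \<in> D \<Longrightarrow> min_on X (group_sum h l s) * lam d \<le> \<nu> l s d"
    and upper: "\<And>l s d. l \<in> D \<Longrightarrow> s \<in> \<J> \<Longrightarrow> d \<in> D \<Longrightarrow> \<nu> l s d \<le> max_on X (group_sum h l s) * lam d"
    and epi: "\<And>l s. l \<in> D \<Longrightarrow> s \<in> \<J> \<Longrightarrow> group_sum h l s x \<le> \<alpha> l s"
    using feas unfolding split_feasible_def by auto
  define \<alpha>' where "\<alpha>' l = merge_split A B (\<alpha> l)" for l
  define \<nu>' where "\<nu>' l s d = merge_split A B (\<lambda>t. \<nu> l t d) s" for l s d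
  have "\<alpha>' l s = (\<Sum>d\<in>D. \<nu>' l s d)" if "l \<in> D" "s \<in> \<I>" for l s
    using alpha[OF that(1)] in\<J> old[OF that(2)]
    by (simp add: \<alpha>'_def \<nu>'_def merge_split_def sum.distrib)
  moreover have "(\<Sum>s\<in>\<I>. \<nu>' l s l) \<le> b l * lam l" if "l \<in> D" for l
    using coupling[OF that] sum_merge_split[OF _ dis AB, of "\<lambda>t. \<nu> l t l"]
    by (simp add: \<nu>'_def \<J>)
  moreover have "min_on X (group_sum h l s) * lam d \<le> \<nu>' l s d" if "l \<in> D" "s \<in> \<I>" "d \<in> D" for l s d
    using lower[OF that(1) in\<J>(1) that(3)] lower[OF that(1) in\<J>(2) that(3)]
      lower[OF that(1) old[OF that(2)] that(3)]
    by (simp add: \<nu>'_def merge_split_def min_on_Un[OF assms(7) that(1) AB(4)] distrib_right)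
  moreover have "\<nu>' l s d \<le> max_on X (group_sum h l s) * lam d" if "l \<in> D" "s \<in> \<I>" "d \<in> D" for l s d
    using upper[OF that(1) in\<J>(1) that(3)] upper[OF that(1) in\<J>(2) that(3)]
      upper[OF that(1) old[OF that(2)] that(3)]
    by (simp add: \<nu>'_def merge_split_def max_on_Un[OF assms(7) that(1) AB(4)] distrib_right)
  moreover have "group_sum h l s x \<le> \<alpha>' l s" if "l \<in> D" "s \<in> \<I>" for l s
    using epi[OF that(1) in\<J>(1)] epi[OF that(1) in\<J>(2)] epi[OF that(1) old[OF that(2)]]
    by (simp add: \<alpha>'_def merge_split_def group_sum_Un[OF AB(4)])
  ultimately have "(x, \<alpha>', \<nu>', lam) \<in> split_relaxation X D h b \<I>"
    using x lam unfolding split_feasible_def by simp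
  then show "x \<in> proj_x (split_relaxation X D h b \<I>)"
    by (metis fst_conv image_eqI)
qed

end
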